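(* Assume that the continuity and compactness condition holds, that the strict dissipativity condition holds with a minimal optimal periodic orbit $\varPi^\star$, and that the local controllability condition at $\varPi^\star$ and the finite-time reachability condition for $\varPi^\star$ hold. Let $x\in\mathbb{X}$. Then $\lim_{N\to\infty}\bar V^{\mathrm{ces}}_N(x)$ exists and is finite.
   Context: Notation: $\mathbb{N}=\{1,2,\dots\}$; $\mathbb{I}_{[a,b]}$ is the set of integers in $[a,b]$; $[k]_p$ is the remainder of $k$ modulo $p$. $\alpha\in\mathcal{K}_\infty$ means $\alpha:[0,\infty)\to[0,\infty)$ is continuous, strictly increasing, $\alpha(0)=0$, $\lim_{t\to\infty}\alpha(t)=\infty$. System: $x(k+1)=f(x(k),u(k))$, $\mathbb{X}\subset\mathbb{R}^n$, $\mathbb{U}\subset\mathbb{R}^m$, $f:\mathbb{X}\times\mathbb{U}\to\mathbb{R}^n$, stage cost $\ell:\mathbb{X}\times\mathbb{U}\to\mathbb{R}$. $x_u(0,x)=x$, $x_u(k+1,x)=f(x_u(k,x),u(k))$. $\mathbb{U}^N(x)=\{u\in\mathbb{U}^N: x_u(k,x)\in\mathbb{X}\ \forall k\in\mathbb{I}_{[0,N]}\}$; $\mathbb{U}^\infty(x)$ is the analogous set of infinite sequences. $\ell^\star=\inf_{u\in\mathbb{U}^\infty(x)}\liminf_{N\to\infty}\frac1N\sum_{k=0}^{N-1}\ell(x_u(k,x),u(k))$, assumed to be a constant independent of $x$; $\bar\ell=\ell-\ell^\star$. Cesàro value function: $\bar V^{\mathrm{ces}}_N(x)=\inf_{u\in\mathbb{U}^N(x)}\frac1N\sum_{n=0}^{N-1}\sum_{k=0}^{n}\bar\ell(x_u(k,x),u(k))$.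 Periodic orbits: a feasible $p$-periodic orbit is a tuple $\varPi=((x_0,u_0),\dots,(x_{p-1},u_{p-1}))\in(\mathbb{X}\times\mathbb{U})^p$, with $\varPi(k)=(x_k,u_k)$ and $\varPi_{\mathbb{X}}=(x_0,\dots,x_{p-1})$, such that $\varPi_{\mathbb{X}}([k+1]_p)=f(\varPi(k))$ for all $k\in\mathbb{I}_{[0,p-1]}$; $S^p_\varPi$ is the set of these. It is minimal if $\varPi_{\mathbb{X}}(k)=\varPi_{\mathbb{X}}(j)$ implies $k=j$. $\|(x,u)\|_\varPi=\min_k\|(x,u)-\varPi(k)\|$ and $\|x\|_{\varPi_{\mathbb{X}}}=\min_k\|x-\varPi_{\mathbb{X}}(k)\|$. $\ell^p(\varPi)=\frac1p\sum_{k=0}^{p-1}\ell(\varPi(k))$. A $p^\star$-periodic orbit $\varPi^\star$ is optimal if $\ell^{p^\star}(\varPi^\star)=\inf_{p\in\mathbb{N},\varPi\in S^p_\varPi}\ell^p(\varPi)$. Conditions. Continuity and compactness: $f,\ell$ are continuous, $\mathbb{X}\times\mathbb{U}$ is compact, and $\mathbb{U}^N(x)\neq\emptyset$ for all $x\in\mathbb{X}$, $N\in\mathbb{N}$. Strict dissipativity: there exist a minimal optimal periodic orbit $\varPi^\star$, a continuous $\lambda:\mathbb{X}\to\mathbb{R}$, $\bar\lambda\in\mathbb{R}$ with $|\lambda(x)|\le\bar\lambda$ on $\mathbb{X}$, and $\alpha_{\tilde\ell}\in\mathcal{K}_\infty$ with $\tilde\ell(x,u):=\bar\ell(x,u)+\lambda(x)-\lambda(f(x,u))\ge\alpha_{\tilde\ell}(\|(x,u)\|_{\varPi^\star})$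 for all $x\in\mathbb{X}$, $u\in\mathbb{U}^1(x)$. Local controllability at $\varPi^\star$: there exist $\kappa>0$, $M'\in\mathbb{N}$, $\rho\in\mathcal{K}_\infty$ such that for all $z\in\varPi^\star_{\mathbb{X}}$ and all $x,y\in\mathbb{X}$ with $\|x-z\|\le\kappa$, $\|y-z\|\le\kappa$ there is $u\in\mathbb{U}^{M'}(x)$ with $x_u(M',x)=y$ and $\|(x_u(k,x),u(k))\|_{\varPi^\star}\le\rho(\max\{\|x\|_{\varPi^\star_{\mathbb{X}}},\|y\|_{\varPi^\star_{\mathbb{X}}}\})$ for all $k\in\mathbb{I}_{[0,M'-1]}$. Finite-time reachability of $\varPi^\star$: for the same $\kappa$ there is an integer $M''\ge1$ such that for all $x\in\mathbb{X}$ there exist $K\in\mathbb{I}_{[0,M'']}$ and $u\in\mathbb{U}^K(x)$ with $\|x_u(K,x)\|_{\varPi^\star_{\mathbb{X}}}\le\kappa$. *)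

theory Defs
  imports "HOL-Analysis.Analysis"
begin

text \<open>
  States live in \<open>real ^ 'n\<close>, controls in \<open>real ^ 'm\<close>; the norm on pairs is then the Euclidean norm
  of \<open>\<real>\<^sup>n\<^sup>+\<^sup>m\<close>. The maps \<open>f\<close> and \<open>l\<close> are total functions of which only the values on \<open>X \<times> U\<close> are used.
  Infima and limits inferior are taken in \<^typ>\<open>ereal\<close>, so that they carry no hidden boundedness or
  nonemptiness assumption.
\<close>

definition class_K_inf :: "(real \<Rightarrow> real) \<Rightarrow> bool" where
  "class_K_inf \<alpha> \<longleftrightarrow>
     \<alpha> ` {0..} \<subseteq> {0..} \<and> continuous_on {0..} \<alpha> \<and> strict_mono_on {0..} \<alpha> \<and>
     \<alpha> 0 = 0 \<and> filterlim \<alpha> at_top at_top"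

fun traj :: "((real ^ 'n) \<times> (real ^ 'm) \<Rightarrow> real ^ 'n) \<Rightarrow> (nat \<Rightarrow> real ^ 'm) \<Rightarrow> real ^ 'n \<Rightarrow> nat \<Rightarrow> real ^ 'n" where
  "traj f u x 0 = x"
| "traj f u x (Suc k) = f (traj f u x k, u k)"

text \<open>
  A control sequence of length \<open>N\<close> is represented by a function on \<open>nat\<close> whose values from index \<open>N\<close>
  on are unconstrained; they do not influence the trajectory up to time \<open>N\<close>.
\<close>

definition controls ::
  "(real ^ 'n) set \<Rightarrow> (real ^ 'm) set \<Rightarrow> ((real ^ 'n) \<times> (real ^ 'm) \<Rightarrow> real ^ 'n) \<Rightarrow> nat \<Rightarrow> real ^ 'n \<Rightarrow>
   (nat \<Rightarrow> real ^ 'm) set" where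
  "controls X U f N x = {u. (\<forall>k<N. u k \<in> U) \<and> (\<forall>k\<le>N. traj f u x k \<in> X)}"

definition controls_inf ::
  "(real ^ 'n) set \<Rightarrow> (real ^ 'm) set \<Rightarrow> ((real ^ 'n) \<times> (real ^ 'm) \<Rightarrow> real ^ 'n) \<Rightarrow> real ^ 'n \<Rightarrow>
   (nat \<Rightarrow> real ^ 'm) set" where
  "controls_inf X U f x = {u. (\<forall>k. u k \<in> U) \<and> (\<forall>k. traj f u x k \<in> X)}"

definition optimal_average ::
  "(real ^ 'n) set \<Rightarrow> (real ^ 'm) set \<Rightarrow> ((real ^ 'n) \<times> (real ^ 'm) \<Rightarrow> real ^ 'n) \<Rightarrow>
   ((real ^ 'n) \<times> (real ^ 'm) \<Rightarrow> real) \<Rightarrow> real ^ 'n \<Rightarrow> ereal" where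
  "optimal_average X U f l x =
     (INF u\<in>controls_inf X U f x.
        liminf (\<lambda>N. ereal (1 / real N * (\<Sum>k<N. l (traj f u x k, u k)))))"

text \<open>The argument \<open>lstar\<close> is the common value of \<open>optimal_average X U f l\<close> on \<open>X\<close>.\<close>

definition shifted_cost ::
  "((real ^ 'n) \<times> (real ^ 'm) \<Rightarrow> real) \<Rightarrow> real \<Rightarrow> (real ^ 'n) \<times> (real ^ 'm) \<Rightarrow> real" where
  "shifted_cost l lstar z = l z - lstar"

definition cesaro_value ::
  "(real ^ 'n) set \<Rightarrow> (real ^ 'm) set \<Rightarrow> ((real ^ 'n) \<times> (real ^ 'm) \<Rightarrow> real ^ 'n) \<Rightarrow>
   ((real ^ 'n) \<times> (real ^ 'm) \<Rightarrow> real) \<Rightarrow> real \<Rightarrow> nat \<Rightarrow> real ^ 'n \<Rightarrow> ereal" where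
  "cesaro_value X U f l lstar N x =
     (INF u\<in>controls X U f N x.
        ereal (1 / real N * (\<Sum>n<N. \<Sum>k\<le>n. shifted_cost l lstar (traj f u x k, u k))))"

text \<open>A \<open>p\<close>-periodic orbit is a list of length \<open>p\<close> of state-control pairs.\<close>

definition feasible_orbits ::
  "(real ^ 'n) set \<Rightarrow> (real ^ 'm) set \<Rightarrow> ((real ^ 'n) \<times> (real ^ 'm) \<Rightarrow> real ^ 'n) \<Rightarrow> nat \<Rightarrow>
   ((real ^ 'n) \<times> (real ^ 'm)) list set" where
  "feasible_orbits X U f p =
     {P. length P = p \<and> set P \<subseteq> X \<times> U \<and> (\<forall>k<p. fst (P ! ((k + 1) mod p)) = f (P ! k))}"

definition minimal_orbit :: "((real ^ 'n) \<times> (real ^ 'm)) list \<Rightarrow> bool" where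
  "minimal_orbit P \<longleftrightarrow>
     (\<forall>k<length P. \<forall>j<length P. fst (P ! k) = fst (P ! j) \<longrightarrow> k = j)"

definition orbit_dist ::
  "((real ^ 'n) \<times> (real ^ 'm)) list \<Rightarrow> (real ^ 'n) \<times> (real ^ 'm) \<Rightarrow> real" where
  "orbit_dist P z = (MIN k\<in>{..<length P}. norm (z - P ! k))"

definition orbit_state_dist :: "((real ^ 'n) \<times> (real ^ 'm)) list \<Rightarrow> real ^ 'n \<Rightarrow> real" where
  "orbit_state_dist P x = (MIN k\<in>{..<length P}. norm (x - fst (P ! k)))"

definition orbit_cost ::
  "((real ^ 'n) \<times> (real ^ 'm) \<Rightarrow> real) \<Rightarrow> ((real ^ 'n) \<times> (real ^ 'm)) list \<Rightarrow> real" where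
  "orbit_cost l P = 1 / real (length P) * (\<Sum>k<length P. l (P ! k))"

definition optimal_orbit ::
  "(real ^ 'n) set \<Rightarrow> (real ^ 'm) set \<Rightarrow> ((real ^ 'n) \<times> (real ^ 'm) \<Rightarrow> real ^ 'n) \<Rightarrow>
   ((real ^ 'n) \<times> (real ^ 'm) \<Rightarrow> real) \<Rightarrow> ((real ^ 'n) \<times> (real ^ 'm)) list \<Rightarrow> bool" where
  "optimal_orbit X U f l P \<longleftrightarrow>
     1 \<le> length P \<and> P \<in> feasible_orbits X U f (length P) \<and>
     ereal (orbit_cost l P) = (INF p\<in>{1..}. INF Q\<in>feasible_orbits X U f p. ereal (orbit_cost l Q))"

definition continuity_compactness ::
  "(real ^ 'n) set \<Rightarrow> (real ^ 'm) set \<Rightarrow> ((real ^ 'n) \<times> (real ^ 'm) \<Rightarrow> real ^ 'n) \<Rightarrow>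
   ((real ^ 'n) \<times> (real ^ 'm) \<Rightarrow> real) \<Rightarrow> bool" where
  "continuity_compactness X U f l \<longleftrightarrow>
     continuous_on (X \<times> U) f \<and> continuous_on (X \<times> U) l \<and> compact (X \<times> U) \<and>
     (\<forall>x\<in>X. \<forall>N\<ge>1. controls X U f N x \<noteq> {})"

definition strictly_dissipative ::
  "(real ^ 'n) set \<Rightarrow> (real ^ 'm) set \<Rightarrow> ((real ^ 'n) \<times> (real ^ 'm) \<Rightarrow> real ^ 'n) \<Rightarrow>
   ((real ^ 'n) \<times> (real ^ 'm) \<Rightarrow> real) \<Rightarrow> real \<Rightarrow> ((real ^ 'n) \<times> (real ^ 'm)) list \<Rightarrow> bool" where
  "strictly_dissipative X U f l lstar P \<longleftrightarrow>
     minimal_orbit P \<and> optimal_orbit X U f l P \<and>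
     (\<exists>lam :: real ^ 'n \<Rightarrow> real. \<exists>lambar :: real. \<exists>\<alpha>.
        continuous_on X lam \<and> (\<forall>x\<in>X. \<bar>lam x\<bar> \<le> lambar) \<and> class_K_inf \<alpha> \<and>
        (\<forall>x\<in>X. \<forall>u\<in>controls X U f 1 x.
           shifted_cost l lstar (x, u 0) + lam x - lam (f (x, u 0)) \<ge> \<alpha> (orbit_dist P (x, u 0))))"

definition locally_controllable ::
  "(real ^ 'n) set \<Rightarrow> (real ^ 'm) set \<Rightarrow> ((real ^ 'n) \<times> (real ^ 'm) \<Rightarrow> real ^ 'n) \<Rightarrow>
   ((real ^ 'n) \<times> (real ^ 'm)) list \<Rightarrow> real \<Rightarrow> bool" where
  "locally_controllable X U f P \<kappa> \<longleftrightarrow>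
     \<kappa> > 0 \<and>
     (\<exists>M'\<ge>1. \<exists>\<rho>. class_K_inf \<rho> \<and>
        (\<forall>z\<in>fst ` set P. \<forall>x\<in>X. \<forall>y\<in>X. norm (x - z) \<le> \<kappa> \<longrightarrow> norm (y - z) \<le> \<kappa> \<longrightarrow>
           (\<exists>u\<in>controls X U f M' x. traj f u x M' = y \<and>
              (\<forall>k<M'. orbit_dist P (traj f u x k, u k)
                        \<le> \<rho> (max (orbit_state_dist P x) (orbit_state_dist P y))))))"

definition finite_time_reachable ::
  "(real ^ 'n) set \<Rightarrow> (real ^ 'm) set \<Rightarrow> ((real ^ 'n) \<times> (real ^ 'm) \<Rightarrow> real ^ 'n) \<Rightarrow>
   ((real ^ 'n) \<times> (real ^ 'm)) list \<Rightarrow> real \<Rightarrow> bool" where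
  "finite_time_reachable X U f P \<kappa> \<longleftrightarrow>
     (\<exists>M''\<ge>1. \<forall>x\<in>X. \<exists>K\<le>M''. \<exists>u\<in>controls X U f K x. orbit_state_dist P (traj f u x K) \<le> \<kappa>)"

end

theory Submission
  imports Defs
begin

text \<open>
  Let \<open>c\<close> be the rotated cost of the strict dissipativity inequality. Summing by parts, the Cesaro cost of
  a control of length \<open>N\<close> is the sum of \<open>(1 - k/N) c\<^sub>k\<close> plus the average of the storage function \<open>\<lambda>\<close> along
  the trajectory minus \<open>\<lambda>(x)\<close>. A continuous function \<open>\<psi>\<close> is, on the optimal orbit, its orbit average plus
  a coboundary; since \<open>c\<close> is bounded away from zero off the orbit, sums of \<open>\<psi>\<close> along arbitrary
  trajectories therefore differ from \<open>N\<close> times the orbit average by at most \<open>H + \<epsilon> N + C \<Sum>c\<^sub>k\<close>. With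
  \<open>\<psi> = c\<close> this shows that \<open>c\<close> vanishes on the orbit, and with \<open>\<psi> = \<lambda>\<close> it controls the average of \<open>\<lambda>\<close>.
  The limit is \<open>S + \<lambda>\<^sub>P - \<lambda>(x)\<close>, where \<open>S\<close> is the least rotated cost of hitting the orbit exactly in
  finite time and \<open>\<lambda>\<^sub>P\<close> is the orbit average of \<open>\<lambda>\<close>.
\<close>

section \<open>Trajectories\<close>

lemma controls_mono:
  assumes "u \<in> controls X U f N x" "M \<le> N"
  shows "u \<in> controls X U f M x"
  using assms by (auto simp: controls_def)

lemma traj_cong:
  assumes "\<And>k. k < n \<Longrightarrow> u k = v k"
  shows "traj f u x n = traj f v x n"
  using assms by (induction n) auto

definition append_control :: "nat \<Rightarrow> (nat \<Rightarrow> 'a) \<Rightarrow> (nat \<Rightarrow> 'a) \<Rightarrow> nat \<Rightarrow> 'a" where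
  "append_control M u v k = (if k < M then u k else v (k - M))"

lemma traj_append_control_le: "k \<le> M \<Longrightarrow> traj f (append_control M u v) x k = traj f u x k"
  by (rule traj_cong) (auto simp: append_control_def)

lemma traj_append_control_add:
  "traj f (append_control M u v) x (M + k) = traj f v (traj f u x M) k"
proof (induction k)
  case 0
  then show ?case by (simp add: traj_append_control_le)
next
  case (Suc k)
  then show ?case by (simp add: append_control_def[of M u v "M + k"])
qed

lemma append_control_in_controls:
  assumes u: "u \<in> controls X U f M x" and v: "v \<in> controls X U f K (traj f u x M)"
  shows "append_control M u v \<in> controls X U f (M + K) x"
proof -
  have "append_control M u v k \<in> U" if "k < M + K" for k
    using u v that by (auto simp: append_control_def controls_def)
  moreover have "traj f (append_control M u v) x k \<in> X" if "k \<le> M + K" for k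
  proof (cases "k \<le> M")
    case True
    then show ?thesis using u by (auto simp: traj_append_control_le controls_def)
  next
    case False
    then obtain j where "k = M + j" using le_Suc_ex by (metis nat_le_linear)
    then show ?thesis using v that by (auto simp: traj_append_control_add controls_def)
  qed
  ultimately show ?thesis by (auto simp: controls_def)
qed

lemma sum_append_control:
  fixes c :: "(real ^ 'n) \<times> (real ^ 'm) \<Rightarrow> real"
  shows "(\<Sum>k<M + K. c (traj f (append_control M u v) x k, append_control M u v k)) =
    (\<Sum>k<M. c (traj f u x k, u k)) + (\<Sum>k<K. c (traj f v (traj f u x M) k, v k))"
proof -
  have "(\<Sum>k<M. c (traj f (append_control M u v) x k, append_control M u v k)) =
      (\<Sum>k<M. c (traj f u x k, u k))"
    by (rule sum.cong) (auto simp: traj_append_control_le append_control_def)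
  then show ?thesis
    by (induction K) (auto simp: traj_append_control_add append_control_def)
qed

text \<open>The term \<open>a k\<close> occurs in the inner sums with \<open>k \<le> n < N\<close>,
  hence \<open>N - k\<close> times.\<close>

lemma sum_partial_sums:
  fixes a :: "nat \<Rightarrow> real"
  shows "(\<Sum>n<N. \<Sum>k\<le>n. a k) = (\<Sum>k<N. (real N - real k) * a k)"
proof (induction N)
  case (Suc N)
  have "(\<Sum>k<Suc N. (real (Suc N) - real k) * a k) =
      (\<Sum>k<N. (real N - real k) * a k) + (\<Sum>k<N. a k) + a N"
    by (simp add: algebra_simps sum.distrib sum_subtractf)
  then show ?case using Suc by (simp add: lessThan_Suc_atMost[symmetric])
qed auto

lemma eventually_divide_le:
  fixes a e :: real
  assumes "0 < e"
  shows "\<forall>\<^sub>F N in sequentially. a / real N \<le> e"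
proof -
  have "(\<lambda>N. a / real N) \<longlonglongrightarrow> 0" by (rule lim_const_over_n)
  then have "\<forall>\<^sub>F N in sequentially. a / real N < e" using assms by (rule order_tendstoD(2))
  then show ?thesis by eventually_elim simp
qed

section \<open>Distance to the orbit\<close>

lemma orbit_dist_attained:
  assumes "P \<noteq> []"
  obtains k where "k < length P" "orbit_dist P z = norm (z - P ! k)"
proof -
  have "orbit_dist P z \<in> (\<lambda>k. norm (z - P ! k)) ` {..<length P}"
    unfolding orbit_dist_def using assms by (intro Min_in) auto
  then show ?thesis using that by auto
qed

lemma orbit_state_dist_attained:
  assumes "P \<noteq> []"
  obtains k where "k < length P" "orbit_state_dist P y = norm (y - fst (P ! k))"
proof -
  have "orbit_state_dist P y \<in> (\<lambda>k. norm (y - fst (P ! k))) ` {..<length P}"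
    unfolding orbit_state_dist_def using assms by (intro Min_in) auto
  then show ?thesis using that by auto
qed

lemma orbit_state_dist_le: "k < length P \<Longrightarrow> orbit_state_dist P y \<le> norm (y - fst (P ! k))"
  unfolding orbit_state_dist_def by (intro Min_le) auto

lemma orbit_dist_nonneg: "P \<noteq> [] \<Longrightarrow> 0 \<le> orbit_dist P z"
  by (metis orbit_dist_attained norm_ge_zero)

lemma orbit_state_dist_nonneg: "P \<noteq> [] \<Longrightarrow> 0 \<le> orbit_state_dist P y"
  by (metis orbit_state_dist_attained norm_ge_zero)

lemma orbit_state_dist_le_orbit_dist:
  assumes "P \<noteq> []"
  shows "orbit_state_dist P (fst z) \<le> orbit_dist P z"
proof -
  obtain k where k: "k < length P" "orbit_dist P z = norm (z - P ! k)"
    using orbit_dist_attained[OF assms] .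
  have "norm (fst z - fst (P ! k)) \<le> norm (z - P ! k)"
    by (metis fst_diff norm_fst_le prod.collapse)
  then show ?thesis using k orbit_state_dist_le[OF k(1), of "fst z"] by linarith
qed

lemma orbit_state_dist_eq_0:
  assumes "y \<in> fst ` set P"
  shows "orbit_state_dist P y = 0"
proof -
  obtain k where k: "k < length P" "y = fst (P ! k)" using assms by (metis imageE in_set_conv_nth)
  then have "P \<noteq> []" by auto
  then show ?thesis using orbit_state_dist_le[OF k(1), of y] orbit_state_dist_nonneg[of P y] k by simp
qed

section \<open>Strictly dissipative orbits\<close>

text \<open>One storage function and one gain are fixed, since all later constants depend on them.
  That \<open>lstar\<close> is the optimal average enters only where the rotated cost is shown to
  vanish on the orbit.\<close>

locale dissipative_orbit =
  fixes X :: "(real ^ 'n) set" and U :: "(real ^ 'm) set"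
    and f :: "(real ^ 'n) \<times> (real ^ 'm) \<Rightarrow> real ^ 'n"
    and l :: "(real ^ 'n) \<times> (real ^ 'm) \<Rightarrow> real"
    and lstar :: real
    and P :: "((real ^ 'n) \<times> (real ^ 'm)) list"
    and lam :: "real ^ 'n \<Rightarrow> real"
    and \<alpha> :: "real \<Rightarrow> real"
  assumes cont: "continuity_compactness X U f l"
    and orbit_nonempty: "P \<noteq> []"
    and orbit_feasible: "P \<in> feasible_orbits X U f (length P)"
    and orbit_minimal: "minimal_orbit P"
    and lam_cont: "continuous_on X lam"
    and alpha: "class_K_inf \<alpha>"
    and dissipation: "\<And>x u. x \<in> X \<Longrightarrow> u \<in> controls X U f 1 x \<Longrightarrow>
      shifted_cost l lstar (x, u 0) + lam x - lam (f (x, u 0)) \<ge> \<alpha> (orbit_dist P (x, u 0))"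
begin

text \<open>These are the pairs \<open>(x, u 0)\<close> with \<open>x\<close> in \<open>X\<close>
  and \<open>u\<close> in \<open>controls X U f 1 x\<close>, the ones \<open>dissipation\<close>
  speaks of. The set is compact, and \<open>lam\<close> can be evaluated at both ends of a
  step.\<close>

definition admissible :: "((real ^ 'n) \<times> (real ^ 'm)) set" where
  "admissible = {z \<in> X \<times> U. f z \<in> X}"

definition rotated_cost :: "(real ^ 'n) \<times> (real ^ 'm) \<Rightarrow> real" where
  "rotated_cost z = shifted_cost l lstar z + lam (fst z) - lam (f z)"

definition orbit_mean :: "((real ^ 'n) \<times> (real ^ 'm) \<Rightarrow> real) \<Rightarrow> real" where
  "orbit_mean \<psi> = (\<Sum>k<length P. \<psi> (P ! k)) / real (length P)"

lemma orbit_step: "k < length P \<Longrightarrow> f (P ! k) = fst (P ! (Suc k mod length P))"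
  using orbit_feasible by (auto simp: feasible_orbits_def)

lemma orbit_in_product: "k < length P \<Longrightarrow> P ! k \<in> X \<times> U"
  using orbit_feasible nth_mem by (fastforce simp: feasible_orbits_def)

lemma orbit_admissible: "k < length P \<Longrightarrow> P ! k \<in> admissible"
  using orbit_in_product[of k] orbit_in_product[of "Suc k mod length P"] orbit_step[of k] orbit_nonempty
  by (auto simp: admissible_def mem_Times_iff)

lemma compact_X: "compact X"
proof -
  \<comment> \<open>The orbit supplies a control, so that \<open>X\<close> can be recovered as a
    projection of the compact product.\<close>
  have "U \<noteq> {}" using orbit_in_product[of 0] orbit_nonempty by auto
  then have X: "X = fst ` (X \<times> U)" by simp
  have "compact (fst ` (X \<times> U))"
    using cont by (intro compact_continuous_image continuous_intros) (simp add: continuity_compactness_def)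
  then show ?thesis using X by simp
qed

lemma compact_admissible: "compact admissible"
proof -
  have "closed ((X \<times> U) \<inter> f -` X)"
    using cont compact_X
    by (intro continuous_closed_preimage) (auto simp: continuity_compactness_def compact_imp_closed)
  \<comment> \<open>The doubled factor displays the set as a compact set intersected with a closed
    one; \<open>f\<close> is continuous on the product only, so the preimage is taken inside
    it.\<close>
  moreover have "admissible = (X \<times> U) \<inter> ((X \<times> U) \<inter> f -` X)"
    by (auto simp: admissible_def)
  ultimately show ?thesis
    using cont by (metis compact_Int_closed continuity_compactness_def)
qed

lemma continuous_on_state:
  assumes "continuous_on X h"
  shows "continuous_on admissible (\<lambda>z. h (fst z))"
  by (rule continuous_on_compose2[OF assms]) (auto simp: admissible_def intro!: continuous_intros)

lemma continuous_on_successor: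
  assumes "continuous_on X h"
  shows "continuous_on admissible (\<lambda>z. h (f z))"
proof (rule continuous_on_compose2[OF assms])
  show "continuous_on admissible f"
    using cont by (auto simp: continuity_compactness_def admissible_def intro: continuous_on_subset)
qed (auto simp: admissible_def)

lemma rotated_cost_cont: "continuous_on admissible rotated_cost"
proof -
  have "continuous_on admissible l"
    using cont by (auto simp: continuity_compactness_def admissible_def intro: continuous_on_subset)
  then show ?thesis
    unfolding rotated_cost_def shifted_cost_def
    by (intro continuous_intros continuous_on_state continuous_on_successor lam_cont)
qed

lemma alpha_strict_mono: "0 \<le> s \<Longrightarrow> s < t \<Longrightarrow> \<alpha> s < \<alpha> t"
  using alpha by (auto simp: class_K_inf_def strict_mono_on_def)

lemma alpha_mono: "0 \<le> s \<Longrightarrow> s \<le> t \<Longrightarrow> \<alpha> s \<le> \<alpha> t"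
  using alpha_strict_mono by (metis less_eq_real_def)

lemma alpha_pos: "0 < t \<Longrightarrow> 0 < \<alpha> t"
  using alpha_strict_mono[of 0 t] alpha by (auto simp: class_K_inf_def)

lemma rotated_cost_ge: "z \<in> admissible \<Longrightarrow> \<alpha> (orbit_dist P z) \<le> rotated_cost z"
  \<comment> \<open>A pair becomes a control of length one through the constant sequence
    \<open>snd z\<close>.\<close>
  using dissipation[of "fst z" "\<lambda>_. snd z"]
  by (auto simp: admissible_def rotated_cost_def controls_def le_Suc_eq)

lemma rotated_cost_nonneg: "z \<in> admissible \<Longrightarrow> 0 \<le> rotated_cost z"
  using rotated_cost_ge[of z] alpha_mono[of 0 "orbit_dist P z"] orbit_dist_nonneg[OF orbit_nonempty, of z] alpha
  by (auto simp: class_K_inf_def)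

section \<open>Ergodic estimates for continuous functions on admissible pairs\<close>

lemma bounded_on_admissible:
  fixes \<psi> :: "(real ^ 'n) \<times> (real ^ 'm) \<Rightarrow> real"
  assumes "continuous_on admissible \<psi>"
  obtains B where "0 < B" "\<And>z. z \<in> admissible \<Longrightarrow> \<bar>\<psi> z\<bar> \<le> B"
proof -
  have "bounded (\<psi> ` admissible)"
    by (intro compact_imp_bounded compact_continuous_image assms compact_admissible)
  then show ?thesis using that by (auto simp: bounded_pos)
qed

lemma bounded_on_X:
  fixes h :: "real ^ 'n \<Rightarrow> real"
  assumes "continuous_on X h"
  obtains B where "0 < B" "\<And>y. y \<in> X \<Longrightarrow> \<bar>h y\<bar> \<le> B"
proof -
  have "bounded (h ` X)"
    by (intro compact_imp_bounded compact_continuous_image assms compact_X)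
  then show ?thesis using that by (auto simp: bounded_pos)
qed

lemma small_near_orbit:
  fixes \<psi> :: "(real ^ 'n) \<times> (real ^ 'm) \<Rightarrow> real"
  assumes "continuous_on admissible \<psi>" and zero: "\<And>k. k < length P \<Longrightarrow> \<psi> (P ! k) = 0" and "0 < e"
  obtains d where "0 < d" "\<And>z. z \<in> admissible \<Longrightarrow> orbit_dist P z < d \<Longrightarrow> \<bar>\<psi> z\<bar> < e"
proof -
  have "uniformly_continuous_on admissible \<psi>"
    by (intro compact_uniformly_continuous assms compact_admissible)
  then obtain d where d: "0 < d"
    "\<And>y z. y \<in> admissible \<Longrightarrow> z \<in> admissible \<Longrightarrow> dist z y < d \<Longrightarrow> dist (\<psi> z) (\<psi> y) < e"
    unfolding uniformly_continuous_on_def using \<open>0 < e\<close> by metis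
  have "\<bar>\<psi> z\<bar> < e" if z: "z \<in> admissible" "orbit_dist P z < d" for z
  proof -
    obtain k where k: "k < length P" "orbit_dist P z = norm (z - P ! k)"
      using orbit_dist_attained[OF orbit_nonempty] .
    then have "dist (\<psi> z) (\<psi> (P ! k)) < e"
      using d(2)[OF orbit_admissible[OF k(1)] z(1)] z by (auto simp: dist_norm)
    then show ?thesis using zero[OF k(1)] by (auto simp: dist_real_def)
  qed
  then show ?thesis using that d by blast
qed

text \<open>Near the orbit \<open>e\<close> suffices; at distance at least \<open>d\<close> the
  rotated cost is at least \<open>\<alpha> d\<close>, so a multiple of it exceeds the global bound
  of \<open>\<psi>\<close>. The factor is a natural number because it later also counts time
  steps.\<close>

lemma dominated_by_rotated_cost:
  fixes \<psi> :: "(real ^ 'n) \<times> (real ^ 'm) \<Rightarrow> real"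
  assumes \<psi>: "continuous_on admissible \<psi>" and "\<And>k. k < length P \<Longrightarrow> \<psi> (P ! k) = 0" and "0 < e"
  obtains C :: nat where "\<And>z. z \<in> admissible \<Longrightarrow> \<bar>\<psi> z\<bar> \<le> e + real C * rotated_cost z"
proof -
  obtain d where d: "0 < d" "\<And>z. z \<in> admissible \<Longrightarrow> orbit_dist P z < d \<Longrightarrow> \<bar>\<psi> z\<bar> < e"
    using small_near_orbit[OF assms] by metis
  obtain B where B: "0 < B" "\<And>z. z \<in> admissible \<Longrightarrow> \<bar>\<psi> z\<bar> \<le> B"
    using bounded_on_admissible[OF \<psi>] by metis
  obtain C :: nat where C: "B / \<alpha> d \<le> real C" using real_arch_simple by blast
  have "\<bar>\<psi> z\<bar> \<le> e + real C * rotated_cost z" if z: "z \<in> admissible" for z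
  proof (cases "orbit_dist P z < d")
    case True
    have "0 \<le> real C * rotated_cost z" using rotated_cost_nonneg[OF z] by simp
    then show ?thesis using d(2)[OF z True] by linarith
  next
    case False
    have "B \<le> real C * \<alpha> d" using C alpha_pos[OF d(1)] by (simp add: pos_divide_le_eq)
    also have "\<dots> \<le> real C * rotated_cost z"
      using rotated_cost_ge[OF z] alpha_mono[of d "orbit_dist P z"] False d(1)
      by (intro mult_left_mono) auto
    finally show ?thesis using B(2)[OF z] \<open>0 < e\<close> by linarith
  qed
  then show ?thesis using that by blast
qed

text \<open>Deviations from the mean sum to zero over one period, so their partial sums close up
  around the orbit. Minimality makes these sums a function of the state alone, and Tietze's theorem
  extends it continuously from the finite set of orbit states.\<close>

lemma coboundary_on_orbit:
  fixes \<psi> :: "(real ^ 'n) \<times> (real ^ 'm) \<Rightarrow> real"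
  obtains h :: "real ^ 'n \<Rightarrow> real" where "continuous_on UNIV h"
    "\<And>k. k < length P \<Longrightarrow> \<psi> (P ! k) - orbit_mean \<psi> = h (f (P ! k)) - h (fst (P ! k))"
proof -
  define p where "p = length P"
  define g where "g k = (\<Sum>j<k. \<psi> (P ! j) - orbit_mean \<psi>)" for k
  have p: "0 < p" using orbit_nonempty by (simp add: p_def)
  have g0: "g 0 = 0" by (simp add: g_def)
  have gp: "g p = 0" using p by (simp add: g_def orbit_mean_def p_def[symmetric] sum_subtractf)
  have inj: "inj_on (\<lambda>k. fst (P ! k)) {..<p}"
    using orbit_minimal by (auto simp: minimal_orbit_def inj_on_def p_def)
  \<comment> \<open>Off the orbit the value of \<open>h0\<close> is arbitrary; only its values on
    \<open>Q\<close> are extended.\<close>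
  define h0 where "h0 y = g (the_inv_into {..<p} (\<lambda>k. fst (P ! k)) y)" for y
  have h0: "h0 (fst (P ! k)) = g k" if "k < p" for k
    using the_inv_into_f_f[OF inj, of k] that by (simp add: h0_def)
  define Q where "Q = (\<lambda>k. fst (P ! k)) ` {..<p}"
  have "finite Q" by (simp add: Q_def)
  then have "continuous_on Q h0" "closedin (top_of_set UNIV) Q"
    by (auto intro: continuous_on_finite finite_imp_closed)
  then obtain h where h: "continuous_on UNIV h" "\<And>y. y \<in> Q \<Longrightarrow> h y = h0 y"
    using Tietze_unbounded[of Q h0 UNIV] by metis
  have hP: "h (fst (P ! k)) = g k" if "k < p" for k
    using h(2)[of "fst (P ! k)"] h0[OF that] that by (auto simp: Q_def)
  have "\<psi> (P ! k) - orbit_mean \<psi> = h (f (P ! k)) - h (fst (P ! k))" if k: "k < p" for k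
  proof -
    have "h (f (P ! k)) = g (Suc k mod p)"
      using hP[of "Suc k mod p"] orbit_step[of k] k p by (simp add: p_def)
    \<comment> \<open>At the last index the wraparound is harmless, since \<open>g 0\<close> and
      \<open>g p\<close> both vanish.\<close>
    also have "\<dots> = g (Suc k)"
      using k g0 gp by (cases "Suc k = p") auto
    finally show ?thesis using hP[OF k] by (simp add: g_def)
  qed
  then show ?thesis using that h(1) by (auto simp: p_def)
qed

abbreviation pair_at :: "(nat \<Rightarrow> real ^ 'm) \<Rightarrow> real ^ 'n \<Rightarrow> nat \<Rightarrow> (real ^ 'n) \<times> (real ^ 'm)" where
  "pair_at u x k \<equiv> (traj f u x k, u k)"

lemma pair_at_admissible:
  assumes "u \<in> controls X U f N x" "k < N"
  shows "pair_at u x k \<in> admissible"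
proof -
  have "traj f u x (Suc k) \<in> X" "traj f u x k \<in> X" "u k \<in> U"
    using assms Suc_leI less_imp_le unfolding controls_def by blast+
  then show ?thesis by (auto simp: admissible_def)
qed

text \<open>Removing the mean and the coboundary from \<open>\<psi>\<close> leaves a function that
  vanishes on the orbit and is dominated by the rotated cost. The coboundary telescopes to two
  bounded end terms. The constants \<open>H\<close> and \<open>C\<close> serve all lengths, initial
  states and controls at once.\<close>

lemma ergodic_estimate:
  fixes \<psi> :: "(real ^ 'n) \<times> (real ^ 'm) \<Rightarrow> real"
  assumes \<psi>: "continuous_on admissible \<psi>" and "0 < e"
  obtains H :: real and C :: nat where
    "\<And>N x u. u \<in> controls X U f N x \<Longrightarrow>
       \<bar>(\<Sum>k<N. \<psi> (pair_at u x k)) - real N * orbit_mean \<psi>\<bar>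
         \<le> H + e * real N + real C * (\<Sum>k<N. rotated_cost (pair_at u x k))"
proof -
  obtain h :: "real ^ 'n \<Rightarrow> real" where h: "continuous_on UNIV h"
    "\<And>k. k < length P \<Longrightarrow> \<psi> (P ! k) - orbit_mean \<psi> = h (f (P ! k)) - h (fst (P ! k))"
    using coboundary_on_orbit by metis
  have hX: "continuous_on X h" using h(1) continuous_on_subset by blast
  obtain B where B: "0 < B" "\<And>y. y \<in> X \<Longrightarrow> \<bar>h y\<bar> \<le> B" using bounded_on_X[OF hX] by metis
  define \<phi> where "\<phi> z = \<psi> z - orbit_mean \<psi> - (h (f z) - h (fst z))" for z
  have "continuous_on admissible \<phi>"
    unfolding \<phi>_def by (intro continuous_intros \<psi> continuous_on_state continuous_on_successor hX)
  moreover have "\<phi> (P ! k) = 0" if "k < length P" for k using h(2)[OF that] by (simp add: \<phi>_def)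
  ultimately obtain C :: nat
    where C: "\<And>z. z \<in> admissible \<Longrightarrow> \<bar>\<phi> z\<bar> \<le> e + real C * rotated_cost z"
    using dominated_by_rotated_cost[OF _ _ \<open>0 < e\<close>] by metis
  have "\<bar>(\<Sum>k<N. \<psi> (pair_at u x k)) - real N * orbit_mean \<psi>\<bar>
         \<le> 2 * B + e * real N + real C * (\<Sum>k<N. rotated_cost (pair_at u x k))"
    if u: "u \<in> controls X U f N x" for N x u
  proof -
    have "(\<Sum>k<N. \<phi> (pair_at u x k)) =
        (\<Sum>k<N. \<psi> (pair_at u x k)) - real N * orbit_mean \<psi> - (h (traj f u x N) - h x)" for N
      by (induction N) (auto simp: \<phi>_def algebra_simps)
    moreover have "\<bar>\<Sum>k<N. \<phi> (pair_at u x k)\<bar> \<le> (\<Sum>k<N. e + real C * rotated_cost (pair_at u x k))"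
      using C pair_at_admissible[OF u] by (intro order.trans[OF sum_abs] sum_mono) auto
    moreover have "(\<Sum>k<N. e + real C * rotated_cost (pair_at u x k)) =
        e * real N + real C * (\<Sum>k<N. rotated_cost (pair_at u x k))"
      by (simp add: sum.distrib sum_distrib_left mult.commute)
    moreover have "\<bar>h (traj f u x N)\<bar> \<le> B"
      by (rule B(2)) (use u in \<open>auto simp: controls_def\<close>)
    moreover have "traj f u x 0 \<in> X"
      using u unfolding controls_def by blast
    then have "\<bar>h x\<bar> \<le> B" using B(2) by simp
    ultimately show ?thesis by (smt (verit))
  qed
  then show ?thesis using that[of "2 * B" C] by auto
qed

section \<open>Vanishing of the rotated cost on the orbit\<close>

lemma shifted_cost_sum:
  "(\<Sum>k<n. shifted_cost l lstar (pair_at u x k)) =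
     (\<Sum>k<n. rotated_cost (pair_at u x k)) + lam (traj f u x n) - lam x"
  by (induction n) (auto simp: rotated_cost_def)

text \<open>If the mean were \<open>c > 0\<close>, the ergodic estimate for the rotated cost itself,
  with slack \<open>c / 2\<close>, would force its sums to grow linearly along every trajectory. As
  \<open>lam\<close> is bounded, every average of \<open>l\<close> would then exceed
  \<open>lstar\<close> by a fixed amount in the limit.\<close>

lemma orbit_mean_rotated_cost_nonpos:
  assumes opt: "optimal_average X U f l x = ereal lstar" and x: "x \<in> X"
  shows "orbit_mean rotated_cost \<le> 0"
proof (rule ccontr)
  assume neg: "\<not> ?thesis"
  define c where "c = orbit_mean rotated_cost"
  have c: "0 < c" using neg by (simp add: c_def)
  obtain H :: real and C :: nat where HC:
    "\<And>N x u. u \<in> controls X U f N x \<Longrightarrow>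
       \<bar>(\<Sum>k<N. rotated_cost (pair_at u x k)) - real N * c\<bar>
         \<le> H + c / 2 * real N + real C * (\<Sum>k<N. rotated_cost (pair_at u x k))"
    by (rule ergodic_estimate[OF rotated_cost_cont half_gt_zero[OF c], folded c_def]) blast
  obtain B where B: "0 < B" "\<And>y. y \<in> X \<Longrightarrow> \<bar>lam y\<bar> \<le> B" using bounded_on_X[OF lam_cont] by metis
  \<comment> \<open>This is half of the guaranteed growth rate
    \<open>c / (2 * (1 + real C))\<close>; the other half absorbs \<open>H\<close> and the bound
    \<open>B\<close> of \<open>lam\<close>.\<close>
  define s where "s = c / (4 * (1 + real C))"
  have s: "0 < s" using c by (simp add: s_def)
  have c4: "c = 4 * s * (1 + real C)"
  proof -
    have "0 < 4 * (1 + real C)" by (simp add: add_pos_nonneg)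
    then have "s * (4 * (1 + real C)) = c" unfolding s_def by (metis less_irrefl nonzero_eq_divide_eq)
    then show ?thesis by (simp add: algebra_simps)
  qed
  have ev: "\<forall>\<^sub>F N in sequentially. H / (1 + real C) + 2 * B \<le> real N * s"
  proof -
    obtain N0 :: nat where "(H / (1 + real C) + 2 * B) / s \<le> real N0" using real_arch_simple by blast
    then have "H / (1 + real C) + 2 * B \<le> real N * s" if "N0 \<le> N" for N
      using that s by (simp add: pos_divide_le_eq) (smt (verit) mult_right_mono of_nat_le_iff)
    then show ?thesis by (auto simp: eventually_sequentially)
  qed
  have "ereal (lstar + s) \<le> liminf (\<lambda>N. ereal (1 / real N * (\<Sum>k<N. l (pair_at u x k))))"
    if u: "u \<in> controls_inf X U f x" for u
  proof (rule Liminf_bounded)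
    show "\<forall>\<^sub>F N in sequentially. ereal (lstar + s) \<le> ereal (1 / real N * (\<Sum>k<N. l (pair_at u x k)))"
      using ev eventually_gt_at_top[of 0]
    proof eventually_elim
      case (elim N)
      have uN: "u \<in> controls X U f N x" using u by (auto simp: controls_def controls_inf_def)
      define R where "R = (\<Sum>k<N. rotated_cost (pair_at u x k))"
      have "real N * c / 2 - H \<le> (1 + real C) * R"
        using HC[OF uN] unfolding R_def[symmetric] by (auto simp: algebra_simps abs_le_iff)
      then have "(real N * c / 2 - H) / (1 + real C) \<le> R"
        by (simp add: pos_divide_le_eq mult.commute)
      moreover have "(real N * c / 2 - H) / (1 + real C) = 2 * (real N * s) - H / (1 + real C)"
        using c4 by (simp add: diff_divide_distrib)
      moreover have "\<bar>lam (traj f u x N)\<bar> \<le> B" "\<bar>lam x\<bar> \<le> B"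
        using B(2) u x by (auto simp: controls_inf_def)
      moreover have "(\<Sum>k<N. l (pair_at u x k)) - real N * lstar = R + lam (traj f u x N) - lam x"
        using shifted_cost_sum[of u x N] by (simp add: shifted_cost_def sum_subtractf R_def)
      ultimately have "real N * (lstar + s) \<le> (\<Sum>k<N. l (pair_at u x k))"
        using elim(1) by (simp add: algebra_simps abs_le_iff)
      then show ?case using elim(2) by (simp add: field_simps)
    qed
  qed
  then have "ereal (lstar + s) \<le> optimal_average X U f l x"
    unfolding optimal_average_def by (rule INF_greatest)
  then show False using opt s by simp
qed

text \<open>Dissipation makes every summand of the orbit mean nonnegative, while the mean itself is
  nonpositive.\<close>

lemma rotated_cost_orbit_eq_0:
  assumes "optimal_average X U f l x = ereal lstar" "x \<in> X" "k < length P"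
  shows "rotated_cost (P ! k) = 0"
proof -
  have "(\<Sum>k<length P. rotated_cost (P ! k)) \<le> 0"
    using orbit_mean_rotated_cost_nonpos[OF assms(1,2)] orbit_nonempty
    by (simp add: orbit_mean_def divide_le_0_iff)
  moreover have nonneg: "\<forall>k\<in>{..<length P}. 0 \<le> rotated_cost (P ! k)"
    using rotated_cost_nonneg orbit_admissible by auto
  ultimately have "(\<Sum>k<length P. rotated_cost (P ! k)) = 0"
    by (intro antisym sum_nonneg) auto
  then have "\<forall>k\<in>{..<length P}. rotated_cost (P ! k) = 0"
    using nonneg by (subst (asm) sum_nonneg_eq_0_iff) auto
  then show ?thesis using assms(3) by blast
qed

section \<open>The Cesaro cost in terms of the rotated cost\<close>

text \<open>The storage function telescopes in each inner sum. The inner sum up to \<open>n\<close>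
  has \<open>n + 1\<close> terms, so \<open>lam\<close> is averaged over the times 1 to
  \<open>N\<close>.\<close>

lemma cesaro_cost_eq:
  assumes "0 < N"
  shows "1 / real N * (\<Sum>n<N. \<Sum>k\<le>n. shifted_cost l lstar (pair_at u x k)) =
    (\<Sum>k<N. (1 - real k / real N) * rotated_cost (pair_at u x k)) +
    (\<Sum>n<N. lam (traj f u x (Suc n))) / real N - lam x"
proof -
  have "(\<Sum>k\<le>n. shifted_cost l lstar (pair_at u x k)) =
      (\<Sum>k\<le>n. rotated_cost (pair_at u x k)) + lam (traj f u x (Suc n)) - lam x" for n
    using shifted_cost_sum[of u x "Suc n"] by (simp only: lessThan_Suc_atMost)
  then have "(\<Sum>n<N. \<Sum>k\<le>n. shifted_cost l lstar (pair_at u x k)) =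
      (\<Sum>k<N. (real N - real k) * rotated_cost (pair_at u x k)) +
      (\<Sum>n<N. lam (traj f u x (Suc n))) - real N * lam x"
    by (simp add: sum.distrib sum_subtractf sum_partial_sums del: traj.simps)
  moreover have "1 / real N * (\<Sum>k<N. (real N - real k) * rotated_cost (pair_at u x k)) =
      (\<Sum>k<N. (1 - real k / real N) * rotated_cost (pair_at u x k))"
    unfolding sum_distrib_left using assms by (intro sum.cong) (auto simp: field_simps)
  ultimately show ?thesis using assms
    by (simp add: ring_distribs right_diff_distrib diff_divide_distrib add_divide_distrib del: traj.simps)
qed

text \<open>The ergodic estimate for \<open>lam\<close> covers the times 0 to \<open>N - 1\<close>;
  shifting it to the times 1 to \<open>N\<close> changes the sum by two end values, whence the extra
  \<open>2 * B\<close>.\<close>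

lemma lam_mean_estimate:
  assumes "0 < e"
  obtains H :: real and C :: nat where
    "\<And>N x u. u \<in> controls X U f N x \<Longrightarrow>
       \<bar>(\<Sum>n<N. lam (traj f u x (Suc n))) - real N * orbit_mean (\<lambda>z. lam (fst z))\<bar>
         \<le> H + e * real N + real C * (\<Sum>k<N. rotated_cost (pair_at u x k))"
proof -
  let ?lamP = "orbit_mean (\<lambda>z. lam (fst z))"
  obtain H :: real and C :: nat where HC:
    "\<And>N x u. u \<in> controls X U f N x \<Longrightarrow>
       \<bar>(\<Sum>k<N. lam (fst (pair_at u x k))) - real N * ?lamP\<bar>
         \<le> H + e * real N + real C * (\<Sum>k<N. rotated_cost (pair_at u x k))"
    by (rule ergodic_estimate[OF continuous_on_state[OF lam_cont] assms]) blast
  obtain B where B: "0 < B" "\<And>y. y \<in> X \<Longrightarrow> \<bar>lam y\<bar> \<le> B" using bounded_on_X[OF lam_cont] by metis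
  have "\<bar>(\<Sum>n<N. lam (traj f u x (Suc n))) - real N * ?lamP\<bar>
         \<le> (H + 2 * B) + e * real N + real C * (\<Sum>k<N. rotated_cost (pair_at u x k))"
    if u: "u \<in> controls X U f N x" for N x u
  proof -
    have "traj f u x N \<in> X" "traj f u x 0 \<in> X" using u unfolding controls_def by blast+
    then have "\<bar>lam (traj f u x N)\<bar> \<le> B" "\<bar>lam (traj f u x 0)\<bar> \<le> B" using B(2) by blast+
    moreover have "(\<Sum>n<N. lam (traj f u x (Suc n))) =
        (\<Sum>k<N. lam (traj f u x k)) + lam (traj f u x N) - lam (traj f u x 0)"
      using sum_lessThan_telescope[of "\<lambda>n. lam (traj f u x n)" N]
      by (simp add: sum_subtractf del: traj.simps)
    ultimately show ?thesis using HC[OF u] unfolding fst_conv by linarith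
  qed
  then show ?thesis using that[of "H + 2 * B" C] by auto
qed

section \<open>The cost of hitting the orbit\<close>

text \<open>The orbit must be hit exactly, since from there it can be followed forever at zero
  rotated cost. The infimum is the number \<open>S\<close> of the overview.\<close>

definition hitting_costs :: "real ^ 'n \<Rightarrow> real set" where
  "hitting_costs x = {\<Sum>k<M. rotated_cost (pair_at u x k) | M u.
     u \<in> controls X U f M x \<and> traj f u x M \<in> fst ` set P}"

lemma hitting_costsI:
  "u \<in> controls X U f M x \<Longrightarrow> traj f u x M \<in> fst ` set P \<Longrightarrow>
     (\<Sum>k<M. rotated_cost (pair_at u x k)) \<in> hitting_costs x"
  unfolding hitting_costs_def by blast

lemma hitting_cost_nonneg: "s \<in> hitting_costs x \<Longrightarrow> 0 \<le> s"
  using pair_at_admissible rotated_cost_nonneg by (fastforce simp: hitting_costs_def intro: sum_nonneg)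

lemma Inf_hitting_costs_le: "s \<in> hitting_costs x \<Longrightarrow> Inf (hitting_costs x) \<le> s"
  using hitting_cost_nonneg by (meson bdd_belowI cInf_lower)

text \<open>Concatenation of controls gives one inequality of the dynamic programming principle: the
  least hitting cost is at most the cost so far plus any hitting cost from the current
  state.\<close>

lemma hitting_costs_append:
  assumes u: "u \<in> controls X U f M x" and s: "s \<in> hitting_costs (traj f u x M)"
  shows "(\<Sum>k<M. rotated_cost (pair_at u x k)) + s \<in> hitting_costs x"
proof -
  obtain K v where v: "v \<in> controls X U f K (traj f u x M)" "traj f v (traj f u x M) K \<in> fst ` set P"
    "s = (\<Sum>k<K. rotated_cost (pair_at v (traj f u x M) k))"
    using s by (auto simp: hitting_costs_def)
  show ?thesis
    unfolding hitting_costs_def mem_Collect_eq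
    using v append_control_in_controls[OF u v(1)]
    by (intro exI[of _ "M + K"] exI[of _ "append_control M u v"])
      (simp add: sum_append_control traj_append_control_add)
qed

end

section \<open>Steering to the orbit and following it\<close>

locale controllable_dissipative_orbit = dissipative_orbit X U f l lstar P lam \<alpha>
  for X :: "(real ^ 'n) set" and U :: "(real ^ 'm) set" and f l lstar P lam \<alpha> +
  fixes \<kappa> :: real
  assumes average: "\<And>y. y \<in> X \<Longrightarrow> optimal_average X U f l y = ereal lstar"
    and local_control: "locally_controllable X U f P \<kappa>"
    and reachability: "finite_time_reachable X U f P \<kappa>"
begin

lemma rotated_cost_orbit: "k < length P \<Longrightarrow> rotated_cost (P ! k) = 0"
  using rotated_cost_orbit_eq_0 average orbit_in_product[of 0] orbit_nonempty
  by (metis length_greater_0_conv mem_Times_iff)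

text \<open>The orbit controls are repeated cyclically, starting at the index of
  \<open>y\<close>.\<close>

lemma follow_orbit:
  assumes "y \<in> fst ` set P"
  obtains v where "v \<in> controls_inf X U f y" "\<And>k. rotated_cost (pair_at v y k) = 0"
proof -
  define p where "p = length P"
  have p: "0 < p" using orbit_nonempty by (simp add: p_def)
  obtain j where j: "j < p" "y = fst (P ! j)" using assms by (metis imageE in_set_conv_nth p_def)
  define v where "v k = snd (P ! ((j + k) mod p))" for k
  have traj: "traj f v y k = fst (P ! ((j + k) mod p))" for k
  proof (induction k)
    case (Suc k)
    have "f (P ! ((j + k) mod p)) = fst (P ! (Suc (j + k) mod p))"
      using orbit_step[of "(j + k) mod p"] p by (simp add: p_def[symmetric] mod_Suc_eq)
    then show ?case using Suc by (simp add: v_def)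
  qed (use j in auto)
  then have pair: "pair_at v y k = P ! ((j + k) mod p)" for k by (simp add: v_def)
  have lt: "(j + k) mod p < length P" for k using p by (simp add: p_def[symmetric])
  have "v \<in> controls_inf X U f y"
    using orbit_in_product[OF lt] by (auto simp: controls_inf_def traj v_def mem_Times_iff)
  then show ?thesis using that pair rotated_cost_orbit[OF lt] by metis
qed

text \<open>Local controllability steers \<open>y\<close> to its nearest orbit state in
  \<open>M\<close> steps whose pairs stay within \<open>\<rho>\<close> of the initial distance from
  the orbit. By continuity each step then costs at most \<open>e / M\<close>.\<close>

lemma steer_to_orbit:
  assumes "0 < e"
  obtains d where "0 < d" "\<And>y. y \<in> X \<Longrightarrow> orbit_state_dist P y \<le> d \<Longrightarrow> \<exists>s\<in>hitting_costs y. s \<le> e"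
proof -
  obtain M \<rho> where M: "1 \<le> M" and \<rho>: "class_K_inf \<rho>" and steer:
    "\<And>z x y. z \<in> fst ` set P \<Longrightarrow> x \<in> X \<Longrightarrow> y \<in> X \<Longrightarrow> norm (x - z) \<le> \<kappa> \<Longrightarrow> norm (y - z) \<le> \<kappa> \<Longrightarrow>
      (\<exists>u\<in>controls X U f M x. traj f u x M = y \<and>
         (\<forall>k<M. orbit_dist P (traj f u x k, u k)
           \<le> \<rho> (max (orbit_state_dist P x) (orbit_state_dist P y))))"
    and \<kappa>: "0 < \<kappa>"
    using local_control unfolding locally_controllable_def by blast
  have "0 < e / real M" using assms M by simp
  then obtain r where r: "0 < r"
    "\<And>z. z \<in> admissible \<Longrightarrow> orbit_dist P z < r \<Longrightarrow> \<bar>rotated_cost z\<bar> < e / real M"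
    using small_near_orbit[OF rotated_cost_cont rotated_cost_orbit] by metis
  have "continuous_on {0..} \<rho>" "\<rho> 0 = 0" using \<rho> by (auto simp: class_K_inf_def)
  then obtain d where d: "0 < d" "\<And>t. 0 \<le> t \<Longrightarrow> t < d \<Longrightarrow> \<bar>\<rho> t\<bar> < r"
    using r(1) unfolding continuous_on_iff by (force simp: dist_real_def)
  \<comment> \<open>The bound \<open>\<kappa>\<close> makes local controllability applicable, and
    \<open>d / 2\<close> turns the strict condition on \<open>\<rho>\<close> into a weak
    one.\<close>
  have "\<exists>s\<in>hitting_costs y. s \<le> e" if y: "y \<in> X" "orbit_state_dist P y \<le> min \<kappa> (d / 2)" for y
  proof -
    obtain j where j: "j < length P" "orbit_state_dist P y = norm (y - fst (P ! j))"
      using orbit_state_dist_attained[OF orbit_nonempty] .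
    define z where "z = fst (P ! j)"
    have zP: "z \<in> fst ` set P" using j by (auto simp: z_def)
    have zX: "z \<in> X" using orbit_in_product[OF j(1)] by (auto simp: z_def mem_Times_iff)
    have "orbit_state_dist P z = 0" using orbit_state_dist_eq_0[OF zP] .
    \<comment> \<open>The target lies on the orbit, so the bound depends on the distance of
      \<open>y\<close> alone.\<close>
    then have max: "max (orbit_state_dist P y) (orbit_state_dist P z) = orbit_state_dist P y"
      using orbit_state_dist_nonneg[OF orbit_nonempty, of y] by simp
    obtain u where u: "u \<in> controls X U f M y" "traj f u y M = z"
      "\<And>k. k < M \<Longrightarrow> orbit_dist P (pair_at u y k) \<le> \<rho> (orbit_state_dist P y)"
      using steer[OF zP y(1) zX] y(2) j(2) \<kappa> max by (auto simp: z_def)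
    have "\<rho> (orbit_state_dist P y) < r"
      using d(2)[OF orbit_state_dist_nonneg[OF orbit_nonempty], of y] y(2) d(1) by auto
    then have "rotated_cost (pair_at u y k) \<le> e / real M" if "k < M" for k
      using r(2)[OF pair_at_admissible[OF u(1) that]] u(3)[OF that] by auto
    then have "(\<Sum>k<M. rotated_cost (pair_at u y k)) \<le> (\<Sum>k<M. e / real M)"
      by (intro sum_mono) auto
    also have "\<dots> = e" using M by simp
    finally show ?thesis
      using hitting_costsI[OF u(1)] zP unfolding u(2) by blast
  qed
  then show ?thesis using that[of "min \<kappa> (d / 2)"] \<kappa> d(1) by auto
qed

text \<open>Reachability leads to within \<open>\<kappa>\<close> of the orbit, and local
  controllability with the same \<open>\<kappa>\<close> finishes with an exact hit. This makes the
  real infimum meaningful.\<close>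

lemma hitting_costs_nonempty:
  assumes "x \<in> X"
  shows "hitting_costs x \<noteq> {}"
proof -
  obtain K u where u: "u \<in> controls X U f K x" "orbit_state_dist P (traj f u x K) \<le> \<kappa>"
    using reachability assms unfolding finite_time_reachable_def by blast
  define y where "y = traj f u x K"
  have y: "y \<in> X" using u by (auto simp: controls_def y_def)
  obtain j where j: "j < length P" "orbit_state_dist P y = norm (y - fst (P ! j))"
    using orbit_state_dist_attained[OF orbit_nonempty] .
  have "fst (P ! j) \<in> fst ` set P" "fst (P ! j) \<in> X"
    using j(1) orbit_in_product[OF j(1)] by (auto simp: mem_Times_iff)
  moreover have "norm (y - fst (P ! j)) \<le> \<kappa>" "norm (fst (P ! j) - fst (P ! j)) \<le> \<kappa>"
    using j(2) u(2) local_control by (auto simp: y_def locally_controllable_def)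
  ultimately obtain M v where v: "v \<in> controls X U f M y" "traj f v y M = fst (P ! j)"
    using local_control y unfolding locally_controllable_def by blast
  then have "(\<Sum>k<M. rotated_cost (pair_at v y k)) \<in> hitting_costs y"
    using j(1) by (intro hitting_costsI) auto
  then show ?thesis using hitting_costs_append[OF u(1)] by (auto simp: y_def)
qed

lemma Inf_hitting_costs_nonneg: "x \<in> X \<Longrightarrow> 0 \<le> Inf (hitting_costs x)"
  using hitting_costs_nonempty hitting_cost_nonneg by (intro cInf_greatest) auto

text \<open>Either some step costs less than \<open>\<alpha> d\<close>; its state is then near the
  orbit and can be steered onto it for at most \<open>e\<close>, so the cost up to that step was at
  least \<open>S - e\<close>. Or all steps cost at least \<open>\<alpha> d\<close>, and
  \<open>m\<close> of them add up to \<open>S\<close>. The length \<open>m\<close> works for all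
  controls.\<close>

lemma initial_segment_cost:
  assumes x: "x \<in> X" and e: "0 < e"
  obtains m :: nat where
    "\<And>u. u \<in> controls X U f m x \<Longrightarrow>
       Inf (hitting_costs x) - e \<le> (\<Sum>k<m. rotated_cost (pair_at u x k))"
proof -
  define S where "S = Inf (hitting_costs x)"
  obtain d where d: "0 < d"
    "\<And>y. y \<in> X \<Longrightarrow> orbit_state_dist P y \<le> d \<Longrightarrow> \<exists>s\<in>hitting_costs y. s \<le> e"
    using steer_to_orbit[OF e] by metis
  have ad: "0 < \<alpha> d" using alpha_pos[OF d(1)] .
  obtain m :: nat where m: "S / \<alpha> d \<le> real m" using real_arch_simple by blast
  have "S - e \<le> (\<Sum>k<m. rotated_cost (pair_at u x k))" if u: "u \<in> controls X U f m x" for u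
  proof (cases "\<exists>k<m. rotated_cost (pair_at u x k) < \<alpha> d")
    case True
    then obtain k where k: "k < m" "rotated_cost (pair_at u x k) < \<alpha> d" by blast
    have adm: "pair_at u x j \<in> admissible" if "j < m" for j using pair_at_admissible[OF u that] .
    have "\<alpha> (orbit_dist P (pair_at u x k)) < \<alpha> d"
      using rotated_cost_ge[OF adm[OF k(1)]] k(2) by linarith
    then have "orbit_dist P (pair_at u x k) \<le> d"
      using alpha_mono[of d] d(1) by (meson le_less_linear less_imp_le not_less)
    then have "orbit_state_dist P (traj f u x k) \<le> d"
      using orbit_state_dist_le_orbit_dist[OF orbit_nonempty, of "pair_at u x k"] by simp
    moreover have "traj f u x k \<in> X" using adm[OF k(1)] by (auto simp: admissible_def)
    ultimately obtain s where s: "s \<in> hitting_costs (traj f u x k)" "s \<le> e" using d(2) by blast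
    have "u \<in> controls X U f k x" using controls_mono[OF u] k(1) by simp
    \<comment> \<open>The upper limit is the fixed index of the cheap step; the summation variable
      merely shares its name.\<close>
    then have "S \<le> (\<Sum>k<k. rotated_cost (pair_at u x k)) + s"
      unfolding S_def by (intro Inf_hitting_costs_le hitting_costs_append s)
    also have "(\<Sum>k<k. rotated_cost (pair_at u x k)) \<le> (\<Sum>k<m. rotated_cost (pair_at u x k))"
      using k(1) adm rotated_cost_nonneg by (intro sum_mono2) auto
    finally show ?thesis using s(2) by simp
  next
    case False
    have "S \<le> real m * \<alpha> d" using m ad by (simp add: pos_divide_le_eq)
    also have "\<dots> = (\<Sum>k<m. \<alpha> d)" by simp
    also have "\<dots> \<le> (\<Sum>k<m. rotated_cost (pair_at u x k))"
      using False by (intro sum_mono) (simp only: lessThan_iff, meson not_less)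
    finally show ?thesis using e by simp
  qed
  then show ?thesis using that by (auto simp: S_def)
qed

section \<open>Upper and lower bounds for the Cesaro value\<close>

definition cesaro_limit :: "real ^ 'n \<Rightarrow> real" where
  "cesaro_limit x = Inf (hitting_costs x) + orbit_mean (\<lambda>z. lam (fst z)) - lam x"

text \<open>A nearly optimal hitting control, continued along the orbit, is tested for all
  \<open>N\<close> at once. Its weights are at most 1. One \<open>e\<close> each pays for the
  infimum, for the slack of the ergodic estimate, and for its constants divided by
  \<open>N\<close>.\<close>

lemma cesaro_value_upper:
  assumes x: "x \<in> X" and e: "0 < e"
  shows "\<forall>\<^sub>F N in sequentially. cesaro_value X U f l lstar N x \<le> ereal (cesaro_limit x + 3 * e)"
proof -
  have "\<exists>s\<in>hitting_costs x. s < Inf (hitting_costs x) + e"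
    using hitting_costs_nonempty[OF x] e by (intro cInf_lessD) auto
  then obtain M u where u: "u \<in> controls X U f M x" "traj f u x M \<in> fst ` set P"
    "(\<Sum>k<M. rotated_cost (pair_at u x k)) < Inf (hitting_costs x) + e"
    by (auto simp: hitting_costs_def)
  obtain v where v: "v \<in> controls_inf X U f (traj f u x M)"
    "\<And>k. rotated_cost (pair_at v (traj f u x M) k) = 0"
    using follow_orbit[OF u(2)] by metis
  define w where "w = append_control M u v"
  have w: "w \<in> controls X U f N x" for N
  proof -
    have "v \<in> controls X U f N (traj f u x M)" using v(1) by (auto simp: controls_def controls_inf_def)
    then show ?thesis
      using append_control_in_controls[OF u(1)] controls_mono[of w X U f "M + N" x N] by (simp add: w_def)
  qed
  have nonneg: "0 \<le> rotated_cost (pair_at w x k)" for k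
    using pair_at_admissible[OF w, of k "Suc k"] rotated_cost_nonneg by simp
  define s where "s = (\<Sum>k<M. rotated_cost (pair_at u x k))"
  have sum_w: "(\<Sum>k<N. rotated_cost (pair_at w x k)) \<le> s" for N
  proof -
    \<comment> \<open>Lengthening the range adds nonnegative terms only and lets the sum split at
      the junction \<open>M\<close>.\<close>
    have "(\<Sum>k<N. rotated_cost (pair_at w x k)) \<le> (\<Sum>k<M + N. rotated_cost (pair_at w x k))"
      using nonneg by (intro sum_mono2) auto
    also have "\<dots> = s" by (simp add: w_def sum_append_control v(2) s_def)
    finally show ?thesis .
  qed
  obtain H :: real and C :: nat where HC:
    "\<And>N x u. u \<in> controls X U f N x \<Longrightarrow>
       \<bar>(\<Sum>n<N. lam (traj f u x (Suc n))) - real N * orbit_mean (\<lambda>z. lam (fst z))\<bar>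
         \<le> H + e * real N + real C * (\<Sum>k<N. rotated_cost (pair_at u x k))"
    by (rule lam_mean_estimate[OF e]) blast
  show ?thesis
    using eventually_gt_at_top[of 0] eventually_divide_le[OF e, of "H + real C * s"]
  proof eventually_elim
    case (elim N)
    have "(\<Sum>k<N. (1 - real k / real N) * rotated_cost (pair_at w x k)) \<le>
        (\<Sum>k<N. rotated_cost (pair_at w x k))"
      using nonneg by (intro sum_mono mult_left_le_one_le) auto
    also have "\<dots> \<le> s" by (rule sum_w)
    also have "\<dots> < Inf (hitting_costs x) + e" using u(3) by (simp add: s_def)
    finally have cost: "(\<Sum>k<N. (1 - real k / real N) * rotated_cost (pair_at w x k)) <
        Inf (hitting_costs x) + e" .
    have "(\<Sum>n<N. lam (traj f w x (Suc n))) \<le>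
        real N * orbit_mean (\<lambda>z. lam (fst z)) + e * real N + (H + real C * s)"
      using HC[OF w[of N]] mult_left_mono[OF sum_w[of N], of "real C"] by linarith
    then have "(\<Sum>n<N. lam (traj f w x (Suc n))) / real N \<le>
        (real N * orbit_mean (\<lambda>z. lam (fst z)) + e * real N + (H + real C * s)) / real N"
      by (intro divide_right_mono) auto
    also have "\<dots> = orbit_mean (\<lambda>z. lam (fst z)) + e + (H + real C * s) / real N"
      using elim(1) by (simp add: add_divide_distrib)
    finally have "1 / real N * (\<Sum>n<N. \<Sum>k\<le>n. shifted_cost l lstar (pair_at w x k))
        \<le> cesaro_limit x + 3 * e"
      unfolding cesaro_cost_eq[OF elim(1)] cesaro_limit_def using cost elim(2) by linarith
    then show ?case
      unfolding cesaro_value_def by (intro INF_lower2[OF w]) simp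
  qed
qed

text \<open>The error of the average of \<open>lam\<close> contains \<open>C / N\<close> times the
  total rotated cost, which is merged into the weights: \<open>1 - k / N\<close> drops to
  \<open>1 - (k + C) / N\<close>. The first \<open>m\<close> indices still contribute at least
  \<open>S - 2 * e\<close>, the average of \<open>lam\<close> loses \<open>2 * e\<close>, and the
  negative weights at the end lose at most \<open>e\<close>.\<close>

lemma cesaro_value_lower:
  assumes x: "x \<in> X" and e: "0 < e"
  shows "\<forall>\<^sub>F N in sequentially. ereal (cesaro_limit x - 5 * e) \<le> cesaro_value X U f l lstar N x"
proof -
  define S where "S = Inf (hitting_costs x)"
  have S: "0 \<le> S" using Inf_hitting_costs_nonneg[OF x] by (simp add: S_def)
  obtain m :: nat where m: "\<And>u. u \<in> controls X U f m x \<Longrightarrow>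
      S - e \<le> (\<Sum>k<m. rotated_cost (pair_at u x k))"
    using initial_segment_cost[OF x e] by (metis S_def)
  obtain B where B: "0 < B" "\<And>z. z \<in> admissible \<Longrightarrow> \<bar>rotated_cost z\<bar> \<le> B"
    using bounded_on_admissible[OF rotated_cost_cont] by metis
  obtain H :: real and C :: nat where HC:
    "\<And>N x u. u \<in> controls X U f N x \<Longrightarrow>
       \<bar>(\<Sum>n<N. lam (traj f u x (Suc n))) - real N * orbit_mean (\<lambda>z. lam (fst z))\<bar>
         \<le> H + e * real N + real C * (\<Sum>k<N. rotated_cost (pair_at u x k))"
    by (rule lam_mean_estimate[OF e]) blast
  show ?thesis
    using eventually_gt_at_top[of 0] eventually_ge_at_top[of "m + C"]
      eventually_divide_le[OF e, of H] eventually_divide_le[OF e, of "real C * real C * B"]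
      eventually_divide_le[OF e, of "real (m + C) * S"]
  proof eventually_elim
    case (elim N)
    have "cesaro_limit x - 5 * e \<le> 1 / real N * (\<Sum>n<N. \<Sum>k\<le>n. shifted_cost l lstar (pair_at u x k))"
      if u: "u \<in> controls X U f N x" for u
    proof -
      define c where "c k = rotated_cost (pair_at u x k)" for k
      \<comment> \<open>A common lower bound for the lowered weights of the first \<open>m\<close>
        indices; it tends to 1 as \<open>N\<close> grows.\<close>
      define q where "q = 1 - real (m + C) / real N"
      have c: "0 \<le> c k" "c k \<le> B" if "k < N" for k
        using pair_at_admissible[OF u that] B(2) rotated_cost_nonneg by (fastforce simp: c_def)+
      have q: "0 \<le> q" "q \<le> 1" using elim(1,2) by (auto simp: q_def field_simps)
      have "real N * orbit_mean (\<lambda>z. lam (fst z)) - e * real N - H - real C * (\<Sum>k<N. c k) \<le>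
          (\<Sum>n<N. lam (traj f u x (Suc n)))"
        using HC[OF u] unfolding c_def by linarith
      then have "(real N * orbit_mean (\<lambda>z. lam (fst z)) - e * real N - H - real C * (\<Sum>k<N. c k)) / real N
          \<le> (\<Sum>n<N. lam (traj f u x (Suc n))) / real N"
        by (intro divide_right_mono) auto
      moreover have "(real N * orbit_mean (\<lambda>z. lam (fst z)) - e * real N - H - real C * (\<Sum>k<N. c k)) / real N
          = orbit_mean (\<lambda>z. lam (fst z)) - e - H / real N - (\<Sum>k<N. real C / real N * c k)"
        using elim(1) by (simp add: diff_divide_distrib sum_distrib_left sum_divide_distrib)
      ultimately have lam_mean: "orbit_mean (\<lambda>z. lam (fst z)) - 2 * e - (\<Sum>k<N. real C / real N * c k)
          \<le> (\<Sum>n<N. lam (traj f u x (Suc n))) / real N"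
        using elim(3) by linarith
      have "S - 2 * e \<le> q * (S - e)"
      proof -
        have "q * S = S - real (m + C) * S / real N" unfolding q_def by (simp add: left_diff_distrib)
        then have "q * (S - e) = S - real (m + C) * S / real N - q * e" by (simp only: right_diff_distrib)
        moreover have "q * e \<le> e" using q e by (simp add: mult_left_le_one_le)
        ultimately show ?thesis using elim(5) by linarith
      qed
      also have "q * (S - e) \<le> q * (\<Sum>k<m. c k)"
        using m[of u] controls_mono[OF u, of m] elim(2) q unfolding c_def by (intro mult_left_mono) auto
      finally have initial: "S - 2 * e \<le> (\<Sum>k<m. q * c k)" by (simp add: sum_distrib_left)
      \<comment> \<open>The weight \<open>1 - (k + C) / N\<close> is negative for at most the last \<open>C\<close> indices, where it is at least \<open>- C / N\<close>.\<close>
      have "(\<Sum>k<m. q * c k) - (\<Sum>k\<in>{N-C..<N}. real C / real N * B) \<le>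
          (\<Sum>k<N. (1 - real k / real N - real C / real N) * c k)"
      proof -
        let ?g = "\<lambda>k. (1 - real k / real N - real C / real N) * c k"
        have "(\<Sum>k<m. q * c k) \<le> (\<Sum>k<m. ?g k)"
          using elim(2) c by (intro sum_mono mult_right_mono)
            (auto simp: q_def add_divide_distrib divide_right_mono)
        also have "\<dots> \<le> (\<Sum>k<N-C. ?g k)"
        proof (rule sum_mono2)
          fix k assume "k \<in> {..<N-C} - {..<m}"
          then have k: "k + C < N" by auto
          have "1 - real k / real N - real C / real N = (real N - real k - real C) / real N"
            using elim(1) by (simp add: diff_divide_distrib)
          also have "\<dots> \<ge> 0" using k by (intro divide_nonneg_nonneg) linarith+
          finally have "0 \<le> 1 - real k / real N - real C / real N" .
          then show "0 \<le> ?g k" using c(1)[of k] k by simp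
        qed (use elim(2) in auto)
        finally have "(\<Sum>k<m. q * c k) \<le> (\<Sum>k<N-C. ?g k)" .
        moreover have "(\<Sum>k\<in>{N-C..<N}. - (real C / real N * B)) \<le> (\<Sum>k\<in>{N-C..<N}. ?g k)"
        proof (rule sum_mono)
          fix k assume "k \<in> {N-C..<N}"
          then have k: "k < N" by simp
          have "- (real C / real N * B) \<le> - (real C / real N) * c k"
            using c(2)[OF k] by (simp add: divide_right_mono mult_left_mono)
          also have "\<dots> \<le> ?g k" using c(1)[OF k] k by (intro mult_right_mono) auto
          finally show "- (real C / real N * B) \<le> ?g k" .
        qed
        moreover have "(\<Sum>k<N. ?g k) = (\<Sum>k<N-C. ?g k) + (\<Sum>k\<in>{N-C..<N}. ?g k)"
          using sum.atLeastLessThan_concat[of 0 "N - C" N ?g] by (simp add: atLeast0LessThan)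
        ultimately show ?thesis by (simp add: sum_negf)
      qed
      moreover have "(\<Sum>k\<in>{N-C..<N}. real C / real N * B) = real C * real C * B / real N"
        using elim(2) by simp
      moreover have "(\<Sum>k<N. (1 - real k / real N - real C / real N) * c k) =
          (\<Sum>k<N. (1 - real k / real N) * c k) - (\<Sum>k<N. real C / real N * c k)"
        by (simp add: left_diff_distrib sum_subtractf)
      ultimately show ?thesis
        unfolding cesaro_cost_eq[OF elim(1)] cesaro_limit_def
        using initial lam_mean elim(4) unfolding S_def c_def by linarith
    qed
    then show ?case
      unfolding cesaro_value_def by (intro INF_greatest) simp
  qed
qed

lemma cesaro_value_tendsto:
  assumes x: "x \<in> X"
  shows "(\<lambda>N. cesaro_value X U f l lstar N x) \<longlonglongrightarrow> ereal (cesaro_limit x)"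
proof (rule order_tendstoI)
  fix a :: ereal
  assume "a < ereal (cesaro_limit x)"
  \<comment> \<open>The bound is an extended real and the estimates are weak inequalities, so a real
    \<open>r\<close> is interposed and \<open>e\<close> is chosen to make the error exactly the gap
    between \<open>r\<close> and the limit.\<close>
  then obtain r where r: "a < ereal r" "ereal r < ereal (cesaro_limit x)" using ereal_dense2 by blast
  then have "\<forall>\<^sub>F N in sequentially.
      ereal (cesaro_limit x - 5 * ((cesaro_limit x - r) / 5)) \<le> cesaro_value X U f l lstar N x"
    by (intro cesaro_value_lower x) simp
  moreover have "cesaro_limit x - 5 * ((cesaro_limit x - r) / 5) = r"
    by (simp add: diff_divide_distrib)
  ultimately show "\<forall>\<^sub>F N in sequentially. a < cesaro_value X U f l lstar N x"
    using less_le_trans[OF r(1)] by (auto elim: eventually_mono)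
next
  fix a :: ereal
  assume "ereal (cesaro_limit x) < a"
  then obtain r where r: "ereal r < a" "ereal (cesaro_limit x) < ereal r" using ereal_dense2 by blast
  then have "\<forall>\<^sub>F N in sequentially.
      cesaro_value X U f l lstar N x \<le> ereal (cesaro_limit x + 3 * ((r - cesaro_limit x) / 3))"
    by (intro cesaro_value_upper x) simp
  moreover have "cesaro_limit x + 3 * ((r - cesaro_limit x) / 3) = r"
    by (simp add: diff_divide_distrib)
  ultimately show "\<forall>\<^sub>F N in sequentially. cesaro_value X U f l lstar N x < a"
    using le_less_trans[OF _ r(1)] by (auto elim: eventually_mono)
qed

end

theorem theorem16:
  fixes X :: "(real ^ 'n) set" and U :: "(real ^ 'm) set"
    and f :: "(real ^ 'n) \<times> (real ^ 'm) \<Rightarrow> real ^ 'n"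
    and l :: "(real ^ 'n) \<times> (real ^ 'm) \<Rightarrow> real"
    and lstar \<kappa> :: real
    and P :: "((real ^ 'n) \<times> (real ^ 'm)) list"
    and x :: "real ^ 'n"
  assumes "\<And>y. y \<in> X \<Longrightarrow> optimal_average X U f l y = ereal lstar"
    and "continuity_compactness X U f l"
    and "strictly_dissipative X U f l lstar P"
    and "locally_controllable X U f P \<kappa>"
    and "finite_time_reachable X U f P \<kappa>"
    and "x \<in> X"
  shows "\<exists>L :: real. (\<lambda>N. cesaro_value X U f l lstar N x) \<longlonglongrightarrow> ereal L"
proof -
  obtain lam \<alpha> where lam: "continuous_on X lam" "class_K_inf \<alpha>"
    "\<And>x u. x \<in> X \<Longrightarrow> u \<in> controls X U f 1 x \<Longrightarrow>
       shifted_cost l lstar (x, u 0) + lam x - lam (f (x, u 0)) \<ge> \<alpha> (orbit_dist P (x, u 0))"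
    using assms(3) unfolding strictly_dissipative_def by blast
  interpret controllable_dissipative_orbit X U f l lstar P lam \<alpha> \<kappa>
    by unfold_locales
      (use assms lam in \<open>auto simp: strictly_dissipative_def optimal_orbit_def\<close>)
  show ?thesis using cesaro_value_tendsto[OF assms(6)] by blast
qed

end
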